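(* Suppose the counterfactual distribution $\mathrm{pr}(Y_0=\cdot\mid Z=1)$ is identifiable (so that both marginal distributions $\mathrm{pr}(Y_1=\cdot\mid Z=1)=\mathrm{pr}(Y=\cdot\mid Z=1)$ and $\mathrm{pr}(Y_0=\cdot\mid Z=1)$ are known), and suppose $Y_0\le Y_1$ (monotonicity). For $k\in\{0,\ldots,J-1\}$ let $\delta_{k\mid 1}=\sum_{j=0}^{k-1}\{\mathrm{pr}(Y_0=j\mid Z=1)-\mathrm{pr}(Y_1=j\mid Z=1)\}$. Then the sharp bounds on $\mathrm{pr}(Y_0\ne y\mid Z=1,Y=y)$ are $$\max\left(0,\ \frac{\mathrm{pr}(Y=y\mid Z=1)-\mathrm{pr}(Y_0=y\mid Z=1)}{\mathrm{pr}(Y=y\mid Z=1)}\right)\le \mathrm{pr}(Y_0\neq y\mid Z=1,Y=y)\le \min\left(1,\ \frac{\delta_{y\mid 1}}{\mathrm{pr}(Y=y\mid Z=1)}\right),$$ and, for $y'\le y$, the sharp bounds on $\mathrm{pr}(Y_0=y'\mid Z=1,Y=y)$ are $$\max\left(0,\ \frac{\mathrm{pr}(Y=y\mid Z=1)+\sum_{k=0}^{y'-1}\mathrm{pr}(Y=k\mid Z=1)-\sum_{\ell=0}^{y}\mathrm{pr}(Y_0=\ell\mid Z=1)+\mathrm{pr}(Y_0=y'\mid Z=1)}{\mathrm{pr}(Y=y\mid Z=1)}\right)$$ $$\le \mathrm{pr}(Y_0=y'\mid Z=1,Y=y)\le \min_{y'<k\le y}\left(1,\ \frac{\mathrm{pr}(Y_0=y'\mid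 Z=1)}{\mathrm{pr}(Y=y\mid Z=1)},\ \frac{\delta_{k\mid 1}}{\mathrm{pr}(Y=y\mid Z=1)}\right),$$ where the last minimum is over the first two quantities and all $\delta_{k\mid 1}/\mathrm{pr}(Y=y\mid Z=1)$ with $y'<k\le y$ (only the first two quantities when $y'=y$).
   Context: $Z\in\{0,1\}$ is a binary treatment, and $Y$ is an observed ordinal outcome with levels $0,\ldots,J-1$ ($J\ge 2$). $Y_1,Y_0\in\{0,\ldots,J-1\}$ are the potential outcomes under treatment and control, all on a common probability space, and $Y=Y_z$ on $\{Z=z\}$. The levels $y,y'\in\{0,\ldots,J-1\}$, with $\mathrm{pr}(Z=1,Y=y)>0$ so that the conditional probabilities are defined. Empty sums are $0$. Write $q_{k\ell\mid 1}=\mathrm{pr}(Y_1=k,Y_0=\ell\mid Z=1)$, so that $\mathrm{pr}(Y_0=y'\mid Z=1,Y=y)=q_{yy'\mid 1}/\mathrm{pr}(Y=y\mid Z=1)$. "Sharp" means: for the given marginals (which are marginals of some joint distribution satisfying monotonicity), the inequalities hold for every nonnegative matrix $(q_{k\ell\mid 1})_{k,\ell=0,\ldots,J-1}$ with $q_{k\ell\mid 1}=0$ for $k<\ell$, row sums $\sum_\ell q_{k\ell\mid 1}=\mathrm{pr}(Y_1=k\mid Z=1)$ and column sums $\sum_k q_{k\ell\mid 1}=\mathrm{pr}(Y_0=\ell\mid Z=1)$, and each of the lower and upper bounds is attained by some such matrix. *)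

theory Defs
  imports "HOL-Probability.Probability"
begin

definition treated_pr :: "'a measure \<Rightarrow> ('a \<Rightarrow> nat) \<Rightarrow> ('a \<Rightarrow> nat) \<Rightarrow> nat \<Rightarrow> real" where
  "treated_pr M Z X k = \<P>(\<omega> in M. X \<omega> = k \<bar> Z \<omega> = 1)"

definition treated_joint ::
    "'a measure \<Rightarrow> ('a \<Rightarrow> nat) \<Rightarrow> ('a \<Rightarrow> nat) \<Rightarrow> ('a \<Rightarrow> nat) \<Rightarrow> nat \<Rightarrow> nat \<Rightarrow> real" where
  "treated_joint M Z Y1 Y0 k l = \<P>(\<omega> in M. Y1 \<omega> = k \<and> Y0 \<omega> = l \<bar> Z \<omega> = 1)"

definition treated_delta ::
    "'a measure \<Rightarrow> ('a \<Rightarrow> nat) \<Rightarrow> ('a \<Rightarrow> nat) \<Rightarrow> ('a \<Rightarrow> nat) \<Rightarrow> nat \<Rightarrow> real" where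
  "treated_delta M Z Y1 Y0 k = (\<Sum>j<k. treated_pr M Z Y0 j - treated_pr M Z Y1 j)"

text \<open>
  Matrices \<open>q k l\<close>, with \<open>k\<close> the level of \<open>Y1\<close> and \<open>l\<close> the level of \<open>Y0\<close>, that have row
  marginal \<open>p1\<close> and column marginal \<open>p0\<close> and satisfy monotonicity. Only the entries with both
  indices below \<open>J\<close> matter; the others are left unconstrained.
\<close>

definition monotone_couplings ::
    "nat \<Rightarrow> (nat \<Rightarrow> real) \<Rightarrow> (nat \<Rightarrow> real) \<Rightarrow> (nat \<Rightarrow> nat \<Rightarrow> real) set" where
  "monotone_couplings J p1 p0 =
    {q. (\<forall>k<J. \<forall>l<J. 0 \<le> q k l) \<and>
        (\<forall>k<J. \<forall>l<J. k < l \<longrightarrow> q k l = 0) \<and>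
        (\<forall>k<J. (\<Sum>l<J. q k l) = p1 k) \<and>
        (\<forall>l<J. (\<Sum>k<J. q k l) = p0 l)}"

definition sharp_bounds :: "'q set \<Rightarrow> ('q \<Rightarrow> real) \<Rightarrow> real \<Rightarrow> real \<Rightarrow> bool" where
  "sharp_bounds C f lo hi \<longleftrightarrow>
    (\<forall>q\<in>C. lo \<le> f q \<and> f q \<le> hi) \<and> (\<exists>q\<in>C. f q = lo) \<and> (\<exists>q\<in>C. f q = hi)"

text \<open>
  The actual joint law of \<open>(Y1, Y0)\<close> among the treated is one of these matrices, and the conditional
  law of \<open>Y0\<close> given \<open>Z = 1\<close>, \<open>Y = y\<close> is its row \<open>y\<close> divided by the treated probability of \<open>y\<close>.
\<close>

lemma treated_joint_in_monotone_couplings: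
  fixes M :: "'a measure" and Z Y1 Y0 :: "'a \<Rightarrow> nat"
  assumes "prob_space M"
    and [measurable]: "Z \<in> measurable M (count_space UNIV)"
      "Y1 \<in> measurable M (count_space UNIV)" "Y0 \<in> measurable M (count_space UNIV)"
    and Y1: "\<And>\<omega>. \<omega> \<in> space M \<Longrightarrow> Y1 \<omega> < J"
    and Y0: "\<And>\<omega>. \<omega> \<in> space M \<Longrightarrow> Y0 \<omega> < J"
    and mono: "AE \<omega> in M. Y0 \<omega> \<le> Y1 \<omega>"
  shows "treated_joint M Z Y1 Y0 \<in> monotone_couplings J (treated_pr M Z Y1) (treated_pr M Z Y0)"
proof -
  interpret prob_space M by fact
  have zero: "treated_joint M Z Y1 Y0 k l = 0" if "k < l" for k l
  proof -
    have "prob {\<omega> \<in> space M. (Y1 \<omega> = k \<and> Y0 \<omega> = l) \<and> Z \<omega> = 1} = 0"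
      using mono that by (intro prob_eq_0_AE) (auto elim!: eventually_mono)
    then show ?thesis by (simp add: treated_joint_def cond_prob_def)
  qed
  have row: "(\<Sum>l<J. treated_joint M Z Y1 Y0 k l) = treated_pr M Z Y1 k" for k
  proof -
    have "{\<omega> \<in> space M. Y1 \<omega> = k \<and> Z \<omega> = 1}
        = (\<Union>l<J. {\<omega> \<in> space M. (Y1 \<omega> = k \<and> Y0 \<omega> = l) \<and> Z \<omega> = 1})"
      using Y0 by auto
    moreover have "prob (\<Union>l<J. {\<omega> \<in> space M. (Y1 \<omega> = k \<and> Y0 \<omega> = l) \<and> Z \<omega> = 1})
        = (\<Sum>l<J. prob {\<omega> \<in> space M. (Y1 \<omega> = k \<and> Y0 \<omega> = l) \<and> Z \<omega> = 1})"
      by (intro finite_measure_finite_Union) (auto simp: disjoint_family_on_def)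
    ultimately show ?thesis
      by (simp add: treated_joint_def treated_pr_def cond_prob_def flip: sum_divide_distrib)
  qed
  have col: "(\<Sum>k<J. treated_joint M Z Y1 Y0 k l) = treated_pr M Z Y0 l" for l
  proof -
    have "{\<omega> \<in> space M. Y0 \<omega> = l \<and> Z \<omega> = 1}
        = (\<Union>k<J. {\<omega> \<in> space M. (Y1 \<omega> = k \<and> Y0 \<omega> = l) \<and> Z \<omega> = 1})"
      using Y1 by auto
    moreover have "prob (\<Union>k<J. {\<omega> \<in> space M. (Y1 \<omega> = k \<and> Y0 \<omega> = l) \<and> Z \<omega> = 1})
        = (\<Sum>k<J. prob {\<omega> \<in> space M. (Y1 \<omega> = k \<and> Y0 \<omega> = l) \<and> Z \<omega> = 1})"
      by (intro finite_measure_finite_Union) (auto simp: disjoint_family_on_def)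
    ultimately show ?thesis
      by (simp add: treated_joint_def treated_pr_def cond_prob_def flip: sum_divide_distrib)
  qed
  have "0 \<le> treated_joint M Z Y1 Y0 k l" for k l
    by (simp add: treated_joint_def cond_prob_def)
  with zero row col show ?thesis by (simp add: monotone_couplings_def)
qed

lemma cond_prob_Y0_eq_treated_joint:
  fixes M :: "'a measure" and Z Y Y1 Y0 :: "'a \<Rightarrow> nat"
  assumes "prob_space M"
    and [measurable]: "Z \<in> measurable M (count_space UNIV)"
      "Y1 \<in> measurable M (count_space UNIV)" "Y0 \<in> measurable M (count_space UNIV)"
    and Y0: "\<And>\<omega>. \<omega> \<in> space M \<Longrightarrow> Y0 \<omega> < J"
    and cons: "\<And>\<omega>. \<omega> \<in> space M \<Longrightarrow> Z \<omega> = 1 \<Longrightarrow> Y \<omega> = Y1 \<omega>"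
    and pos: "\<P>(\<omega> in M. Z \<omega> = 1 \<and> Y \<omega> = y) > 0"
  shows "\<P>(\<omega> in M. Y0 \<omega> \<in> A \<bar> Z \<omega> = 1 \<and> Y \<omega> = y)
    = (\<Sum>l\<in>{..<J} \<inter> A. treated_joint M Z Y1 Y0 y l) / treated_pr M Z Y y"
proof -
  interpret prob_space M by fact
  have eq: "{\<omega> \<in> space M. Z \<omega> = 1 \<and> Y \<omega> = y} = {\<omega> \<in> space M. Y1 \<omega> = y \<and> Z \<omega> = 1}"
    using cons by auto
  have "prob {\<omega> \<in> space M. Y1 \<omega> = y \<and> Z \<omega> = 1} \<le> prob {\<omega> \<in> space M. Z \<omega> = 1}"
    by (intro finite_measure_mono) auto
  with pos eq have posZ: "prob {\<omega> \<in> space M. Z \<omega> = 1} > 0" by simp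
  have "{\<omega> \<in> space M. Y0 \<omega> \<in> A \<and> Z \<omega> = 1 \<and> Y \<omega> = y}
      = (\<Union>l\<in>{..<J} \<inter> A. {\<omega> \<in> space M. (Y1 \<omega> = y \<and> Y0 \<omega> = l) \<and> Z \<omega> = 1})"
    using Y0 cons by auto
  moreover have "prob (\<Union>l\<in>{..<J} \<inter> A. {\<omega> \<in> space M. (Y1 \<omega> = y \<and> Y0 \<omega> = l) \<and> Z \<omega> = 1})
      = (\<Sum>l\<in>{..<J} \<inter> A. prob {\<omega> \<in> space M. (Y1 \<omega> = y \<and> Y0 \<omega> = l) \<and> Z \<omega> = 1})"
    by (intro finite_measure_finite_Union) (auto simp: disjoint_family_on_def)
  moreover have "{\<omega> \<in> space M. Y \<omega> = y \<and> Z \<omega> = 1} = {\<omega> \<in> space M. Z \<omega> = 1 \<and> Y \<omega> = y}"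
    by auto
  ultimately show ?thesis
    using posZ
    by (simp add: treated_joint_def treated_pr_def cond_prob_def flip: sum_divide_distrib)
qed

end

theory Submission imports Defs begin

text \<open>
  Upper bound: subtract a mass \<open>t\<close> from row \<open>y\<close> and column \<open>y'\<close>; the remaining marginals are still
  stochastically ordered exactly when \<open>t\<close> is at most every \<open>\<delta>\<close> between \<open>y'\<close> and \<open>y\<close>, and then the
  quantile coupling of the remaining marginals, plus \<open>t\<close> at the cell \<open>(y, y')\<close>, attains \<open>t\<close>.
  Lower bound: the entry at \<open>(y, y')\<close> exceeds the bound by the mass of the block of cells \<open>(k, l)\<close> with
  \<open>k \<ge> y'\<close>, \<open>k \<noteq> y\<close>, \<open>l \<le> y\<close>, \<open>l \<noteq> y'\<close>. Mass at such a cell can be exchanged with mass at \<open>(y, y')\<close>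
  without violating monotonicity, so finitely many exchanges empty the block or the cell \<open>(y, y')\<close>.
  The bounds for \<open>Y0 \<noteq> y\<close> are the complements of those for \<open>y' = y\<close>.
\<close>

section \<open>Quantile coupling of stochastically ordered marginals\<close>

lemma monotone_couplingsD:
  assumes "q \<in> monotone_couplings J p1 p0"
  shows "k < J \<Longrightarrow> l < J \<Longrightarrow> 0 \<le> q k l"
    and "k < l \<Longrightarrow> l < J \<Longrightarrow> q k l = 0"
    and "k < J \<Longrightarrow> (\<Sum>l<J. q k l) = p1 k"
    and "l < J \<Longrightarrow> (\<Sum>k<J. q k l) = p0 l"
  using assms by (auto simp: monotone_couplings_def)

text \<open>
  The entry at \<open>(k, l)\<close> of the quantile coupling is the length of the intersection of the intervals
  \<open>[F1 k, F1 (Suc k)]\<close> and \<open>[F0 l, F0 (Suc l)]\<close>, with \<open>F1\<close> and \<open>F0\<close> the cumulative sums.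
\<close>

lemma sum_interval_overlap:
  fixes F :: "nat \<Rightarrow> real"
  assumes F: "\<And>l. l < J \<Longrightarrow> F l \<le> F (Suc l)" and "a \<le> b" "F 0 \<le> a" "b \<le> F J"
  shows "(\<Sum>l<J. max 0 (min b (F (Suc l)) - max a (F l))) = b - a"
proof -
  \<comment> \<open>The overlap is the increment from \<open>F l\<close> to \<open>F (Suc l)\<close>
    after both are clamped to \<open>[a, b]\<close>, so the sum telescopes.\<close>
  have "max 0 (min b (F (Suc l)) - max a (F l)) = max a (min b (F (Suc l))) - max a (min b (F l))"
    if "l < J" for l
    using F[OF that] \<open>a \<le> b\<close> by (auto simp: max_def min_def)
  then have "(\<Sum>l<J. max 0 (min b (F (Suc l)) - max a (F l)))
      = (\<Sum>l<J. max a (min b (F (Suc l))) - max a (min b (F l)))"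
    by (intro sum.cong) auto
  also have "\<dots> = max a (min b (F J)) - max a (min b (F 0))"
    by (rule sum_lessThan_telescope)
  finally show ?thesis using assms by auto
qed

lemma monotone_coupling_exists:
  assumes p1: "\<And>k. k < J \<Longrightarrow> 0 \<le> p1 k" and p0: "\<And>l. l < J \<Longrightarrow> 0 \<le> p0 l"
    and le: "\<And>k. k \<le> J \<Longrightarrow> (\<Sum>j<k. p1 j) \<le> (\<Sum>j<k. p0 j)"
    and total: "(\<Sum>j<J. p1 j) = (\<Sum>j<J. p0 j)"
  shows "\<exists>q. q \<in> monotone_couplings J p1 p0"
proof -
  define F1 F0 where "F1 k = (\<Sum>j<k. p1 j)" and "F0 k = (\<Sum>j<k. p0 j)" for k
  define q where "q k l = max 0 (min (F1 (Suc k)) (F0 (Suc l)) - max (F1 k) (F0 l))" for k l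
  have mono1: "F1 i \<le> F1 j" if "i \<le> j" "j \<le> J" for i j
    unfolding F1_def using that p1 by (intro sum_mono2) auto
  have mono0: "F0 i \<le> F0 j" if "i \<le> j" "j \<le> J" for i j
    unfolding F0_def using that p0 by (intro sum_mono2) auto
  have eq: "F1 0 = 0" "F0 0 = 0" "F1 J = F0 J"
    using total by (simp_all add: F1_def F0_def)
  have row: "(\<Sum>l<J. q k l) = p1 k" if "k < J" for k
  proof -
    have "(\<Sum>l<J. q k l) = F1 (Suc k) - F1 k"
      unfolding q_def using that mono0 mono1[of k "Suc k"] mono1[of 0 k] mono1[of "Suc k" J] eq
      by (intro sum_interval_overlap) auto
    then show ?thesis by (simp add: F1_def)
  qed
  have col: "(\<Sum>k<J. q k l) = p0 l" if "l < J" for l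
  proof -
    have "(\<Sum>k<J. q k l) = (\<Sum>k<J. max 0 (min (F0 (Suc l)) (F1 (Suc k)) - max (F0 l) (F1 k)))"
      by (simp add: q_def min.commute max.commute)
    also have "\<dots> = F0 (Suc l) - F0 l"
      using that mono1 mono0[of l "Suc l"] mono0[of 0 l] mono0[of "Suc l" J] eq
      by (intro sum_interval_overlap) auto
    finally show ?thesis by (simp add: F0_def)
  qed
  \<comment> \<open>Here \<open>F1 (Suc k) \<le> F1 l \<le> F0 l\<close>: the interval of row
    \<open>k\<close> ends before that of column \<open>l\<close> begins.\<close>
  have "q k l = 0" if "k < l" "l < J" for k l
    using mono1[of "Suc k" l] le[of l] that by (auto simp: q_def F1_def F0_def)
  with row col have "q \<in> monotone_couplings J p1 p0"
    by (simp add: monotone_couplings_def) (simp add: q_def)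
  then show ?thesis by blast
qed

section \<open>Mass identities for monotone couplings\<close>

text \<open>Rows below \<open>k\<close> have all their mass in columns below \<open>k\<close>, so
  they cancel from the first \<open>k\<close> columns. What remains is the mass crossing level
  \<open>k\<close>, that of \<open>Y0 < k \<le> Y1\<close>; hence the difference is nonnegative and
  dominates every entry of that block.\<close>

lemma monotone_coupling_delta:
  assumes q: "q \<in> monotone_couplings J p1 p0" and "k \<le> J"
  shows "(\<Sum>j<k. p0 j - p1 j) = (\<Sum>j\<in>{k..<J}. \<Sum>l<k. q j l)"
proof -
  have split: "{..<J} = {..<k} \<union> {k..<J}" using \<open>k \<le> J\<close> by auto
  have "p1 j = (\<Sum>l<k. q j l)" if "j < k" for j
  proof -
    have "p1 j = (\<Sum>l<J. q j l)"
      using monotone_couplingsD(3)[OF q] that \<open>k \<le> J\<close> by simp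
    also have "\<dots> = (\<Sum>l<k. q j l)"
      using monotone_couplingsD(2)[OF q] that \<open>k \<le> J\<close> by (intro sum.mono_neutral_right) auto
    finally show ?thesis .
  qed
  moreover have "(\<Sum>l<k. p0 l) = (\<Sum>l<k. \<Sum>j<J. q j l)"
    using monotone_couplingsD(4)[OF q] \<open>k \<le> J\<close> by (intro sum.cong) auto
  moreover have "\<dots> = (\<Sum>j<J. \<Sum>l<k. q j l)" by (rule sum.swap)
  moreover have "\<dots> = (\<Sum>j<k. \<Sum>l<k. q j l) + (\<Sum>j\<in>{k..<J}. \<Sum>l<k. q j l)"
    unfolding split by (intro sum.union_disjoint) auto
  ultimately show ?thesis by (simp add: sum_subtractf)
qed

text \<open>Count the mass of the columns up to \<open>y\<close> other than \<open>y'\<close> by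
  rows. Rows below \<open>y'\<close> lie entirely in these columns, row \<open>y\<close> lacks only
  its entry at \<open>y'\<close>, and the other rows contribute the block on the right.\<close>

lemma monotone_coupling_entry_excess:
  assumes q: "q \<in> monotone_couplings J p1 p0" and "y' \<le> y" "y < J"
  shows "q y y' - (p1 y + (\<Sum>k<y'. p1 k) - (\<Sum>l\<le>y. p0 l) + p0 y')
    = (\<Sum>k\<in>{y'..<J} - {y}. \<Sum>l\<in>{..y} - {y'}. q k l)"
proof -
  let ?L = "{..y} - {y'}"
  have row: "(\<Sum>l\<in>?L. q k l) = p1 k" if "k < y'" for k
  proof -
    have "q k l = 0" if "l < J" "l \<notin> ?L" for l
      using that \<open>k < y'\<close> \<open>y' \<le> y\<close> by (intro monotone_couplingsD(2)[OF q]) auto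
    then have "(\<Sum>l\<in>?L. q k l) = (\<Sum>l<J. q k l)"
      using \<open>y < J\<close> by (intro sum.mono_neutral_left) auto
    then show ?thesis using monotone_couplingsD(3)[OF q] that assms by simp
  qed
  have "(\<Sum>l\<le>y. q y l) = (\<Sum>l<J. q y l)"
    using monotone_couplingsD(2)[OF q] assms by (intro sum.mono_neutral_left) auto
  then have row_y: "(\<Sum>l\<in>?L. q y l) = p1 y - q y y'"
    using monotone_couplingsD(3)[OF q] assms by (simp add: sum_diff1)
  have "(\<Sum>l\<le>y. p0 l) - p0 y' = (\<Sum>l\<in>?L. p0 l)"
    using assms by (simp add: sum_diff1)
  also have "\<dots> = (\<Sum>l\<in>?L. \<Sum>k<J. q k l)"
    using monotone_couplingsD(4)[OF q] assms by (intro sum.cong) auto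
  also have "\<dots> = (\<Sum>k<J. \<Sum>l\<in>?L. q k l)" by (rule sum.swap)
  also have "\<dots> = (\<Sum>k<y'. \<Sum>l\<in>?L. q k l) + (\<Sum>k\<in>{y'..<J}. \<Sum>l\<in>?L. q k l)"
    using assms by (simp add: lessThan_atLeast0 sum.atLeastLessThan_concat)
  also have "(\<Sum>k\<in>{y'..<J}. \<Sum>l\<in>?L. q k l)
      = p1 y - q y y' + (\<Sum>k\<in>{y'..<J} - {y}. \<Sum>l\<in>?L. q k l)"
    using assms unfolding row_y[symmetric] by (intro sum.remove) auto
  also have "(\<Sum>k<y'. \<Sum>l\<in>?L. q k l) = (\<Sum>k<y'. p1 k)"
    using row by simp
  finally show ?thesis by simp
qed

section \<open>Exchanges of mass, for the lower bound\<close>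

text \<open>Mass \<open>e\<close> moves from \<open>(y, y')\<close> and \<open>(k, l)\<close> to
  \<open>(y, l)\<close> and \<open>(k, y')\<close>. Row and column sums are kept, and the receiving
  cells satisfy monotonicity because \<open>l \<le> y\<close> and \<open>y' \<le> k\<close>.\<close>

lemma monotone_coupling_exchange:
  assumes q: "q \<in> monotone_couplings J p1 p0"
    and "y' \<le> y" "y < J" "y' \<le> k" "k < J" "l \<le> y" "k \<noteq> y" "l \<noteq> y'"
    and e: "0 \<le> e" "e \<le> q y y'" "e \<le> q k l"
  shows "(\<lambda>i j. q i j - e * (of_bool (i = y) - of_bool (i = k)) * (of_bool (j = y') - of_bool (j = l)))
    \<in> monotone_couplings J p1 p0"
proof -
  have zero: "q i j - e * (of_bool (i = y) - of_bool (i = k)) * (of_bool (j = y') - of_bool (j = l)) = 0"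
    if "i < j" "j < J" for i j
    using monotone_couplingsD(2)[OF q that] that assms by (auto simp: of_bool_def)
  have nonneg: "0 \<le> q i j - e * (of_bool (i = y) - of_bool (i = k)) * (of_bool (j = y') - of_bool (j = l))"
    if "i < J" "j < J" for i j
    using monotone_couplingsD(1)[OF q that] assms by (auto simp: of_bool_def)
  have "(\<Sum>j<J. of_bool (j = y') - of_bool (j = l)) = (0::real)"
    using assms by (simp add: sum_subtractf of_bool_def)
  then have row: "(\<Sum>j<J. q i j - e * (of_bool (i = y) - of_bool (i = k)) * (of_bool (j = y') - of_bool (j = l)))
      = p1 i" if "i < J" for i
    using monotone_couplingsD(3)[OF q that] by (simp add: sum_subtractf flip: sum_distrib_left)
  have "(\<Sum>i<J. of_bool (i = y) - of_bool (i = k)) = (0::real)"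
    using assms by (simp add: sum_subtractf of_bool_def)
  then have col: "(\<Sum>i<J. q i j - e * (of_bool (i = y) - of_bool (i = k)) * (of_bool (j = y') - of_bool (j = l)))
      = p0 j" if "j < J" for j
    using monotone_couplingsD(4)[OF q that]
    by (simp add: sum_subtractf flip: sum_distrib_left sum_distrib_right)
  show ?thesis using zero nonneg row col by (simp add: monotone_couplings_def)
qed

text \<open>Either alternative attains the lower bound, by the excess formula. The induction is on
  the number of nonzero cells of the block.\<close>

lemma monotone_coupling_entry_or_block_empty:
  assumes "q \<in> monotone_couplings J p1 p0" and y: "y' \<le> y" "y < J"
  shows "\<exists>r\<in>monotone_couplings J p1 p0.
    r y y' = 0 \<or> (\<forall>k\<in>{y'..<J} - {y}. \<forall>l\<in>{..y} - {y'}. r k l = 0)"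
  using assms(1)
proof (induction "card {(k, l) \<in> ({y'..<J} - {y}) \<times> ({..y} - {y'}). q k l \<noteq> 0}"
    arbitrary: q rule: less_induct)
  case less
  note q = less.prems
  let ?N = "\<lambda>q. {(k, l) \<in> ({y'..<J} - {y}) \<times> ({..y} - {y'}). q k l \<noteq> (0::real)}"
  show ?case
  proof (cases "?N q = {}")
    case True
    then show ?thesis using q by blast
  next
    case False
    then obtain k l where kl: "y' \<le> k" "k < J" "k \<noteq> y" "l \<le> y" "l \<noteq> y'" "q k l \<noteq> 0"
      by auto
    define e where "e = min (q y y') (q k l)"
    define r where
      "r i j = q i j - e * (of_bool (i = y) - of_bool (i = k)) * (of_bool (j = y') - of_bool (j = l))"
      for i j
    have "0 \<le> e" using monotone_couplingsD(1)[OF q] kl y by (simp add: e_def)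
    then have r: "r \<in> monotone_couplings J p1 p0"
      unfolding r_def using q y kl by (intro monotone_coupling_exchange) (auto simp: e_def)
    show ?thesis
    proof (cases "q y y' \<le> q k l")
      case True
      then have "r y y' = 0" using kl by (simp add: r_def e_def)
      with r show ?thesis by blast
    next
      case False
      then have "r k l = 0" using kl by (simp add: r_def e_def)
      \<comment> \<open>The other three cells changed lie in row \<open>y\<close> or column
        \<open>y'\<close>, outside the block, so no new nonzero cell appears in it.\<close>
      then have "q i j \<noteq> 0 \<and> (i, j) \<noteq> (k, l)" if "i \<noteq> y" "j \<noteq> y'" "r i j \<noteq> 0" for i j
        using that by (cases "(i, j) = (k, l)") (auto simp: r_def)
      then have "?N r \<subseteq> ?N q - {(k, l)}" by auto
      moreover have "(k, l) \<in> ?N q" using kl by auto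
      ultimately have "?N r \<subset> ?N q" by blast
      moreover have "finite (?N q)"
        by (rule finite_subset[of _ "({y'..<J} - {y}) \<times> ({..y} - {y'})"]) auto
      ultimately have "card (?N r) < card (?N q)" by (rule psubset_card_mono[rotated])
      from less.hyps[OF this r] show ?thesis .
    qed
  qed
qed

section \<open>Attaining the upper bound, and sharpness for a single entry\<close>

text \<open>An inequality is enough: it is applied with \<open>t\<close> equal to an upper bound for
  the entry over all couplings, which forces equality.\<close>

lemma monotone_coupling_entry_ge_exists:
  assumes q: "q \<in> monotone_couplings J p1 p0" and y: "y' \<le> y" "y < J"
    and t: "0 \<le> t" "t \<le> p1 y" "t \<le> p0 y'" "\<And>k. y' < k \<Longrightarrow> k \<le> y \<Longrightarrow> t \<le> (\<Sum>j<k. p0 j - p1 j)"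
  shows "\<exists>r\<in>monotone_couplings J p1 p0. t \<le> r y y'"
proof -
  define p1' p0' where "p1' k = p1 k - t * of_bool (k = y)"
    and "p0' l = p0 l - t * of_bool (l = y')" for k l
  have sum1: "(\<Sum>j<k. p1' j) = (\<Sum>j<k. p1 j) - t * of_bool (y < k)" for k
    by (simp add: p1'_def sum_subtractf of_bool_def flip: sum_distrib_left)
  have sum0: "(\<Sum>j<k. p0' j) = (\<Sum>j<k. p0 j) - t * of_bool (y' < k)" for k
    by (simp add: p0'_def sum_subtractf of_bool_def flip: sum_distrib_left)
  have delta: "0 \<le> (\<Sum>j<k. p0 j - p1 j)" if "k \<le> J" for k
    unfolding monotone_coupling_delta[OF q that]
    using that monotone_couplingsD(1)[OF q] by (intro sum_nonneg) auto
  have "0 \<le> p1 k" "0 \<le> p0 k" if "k < J" for k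
    using that monotone_couplingsD[OF q] by (metis lessThan_iff sum_nonneg)+
  then have "0 \<le> p1' k" "0 \<le> p0' k" if "k < J" for k
    using that t by (auto simp: p1'_def p0'_def)
  \<comment> \<open>The reserved mass leaves the partial sums of \<open>p0\<close> once
    \<open>k > y'\<close> and those of \<open>p1\<close> once \<open>k > y\<close>. The gap shrinks
    by \<open>t\<close> exactly for \<open>y' < k \<le> y\<close>, where \<open>t(4)\<close>
    applies.\<close>
  moreover have "(\<Sum>j<k. p1' j) \<le> (\<Sum>j<k. p0' j)" if "k \<le> J" for k
    using delta[OF that] t(4)[of k] y
    by (auto simp: sum1 sum0 sum_subtractf of_bool_def not_less)
  \<comment> \<open>At \<open>k = J\<close> no rows remain, so the crossing mass is an empty sum and
    the totals agree.\<close>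
  moreover have "(\<Sum>j<J. p1' j) = (\<Sum>j<J. p0' j)"
    using monotone_coupling_delta[OF q order.refl] y by (simp add: sum1 sum0 sum_subtractf)
  ultimately obtain s where s: "s \<in> monotone_couplings J p1' p0'"
    using monotone_coupling_exists by blast
  define r where "r k l = s k l + t * of_bool (k = y) * of_bool (l = y')" for k l
  have "(\<Sum>l<J. r k l) = p1 k" if "k < J" for k
    using monotone_couplingsD(3)[OF s that] y
    by (simp add: r_def sum.distrib p1'_def of_bool_def flip: sum_distrib_left)
  moreover have "(\<Sum>k<J. r k l) = p0 l" if "l < J" for l
    using monotone_couplingsD(4)[OF s that] y
    by (simp add: r_def sum.distrib p0'_def of_bool_def flip: sum_distrib_left sum_distrib_right)
  ultimately have "r \<in> monotone_couplings J p1 p0"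
    using monotone_couplingsD(1,2)[OF s] t(1) y
    by (auto simp: monotone_couplings_def r_def)
  moreover have "t \<le> r y y'" using monotone_couplingsD(1)[OF s] y by (simp add: r_def)
  ultimately show ?thesis by blast
qed

lemma sharp_bounds_monotone_coupling_entry:
  assumes q: "q \<in> monotone_couplings J p1 p0" and y: "y' \<le> y" "y < J"
  shows "sharp_bounds (monotone_couplings J p1 p0) (\<lambda>q. q y y')
    (max 0 (p1 y + (\<Sum>k<y'. p1 k) - (\<Sum>l\<le>y. p0 l) + p0 y'))
    (Min ({p1 y, p0 y'} \<union> (\<lambda>k. \<Sum>j<k. p0 j - p1 j) ` {y'<..y}))"
    (is "sharp_bounds ?C _ (max 0 ?lo) (Min ?S)")
proof -
  have lower: "max 0 ?lo \<le> r y y'" if r: "r \<in> ?C" for r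
  proof -
    have "0 \<le> (\<Sum>k\<in>{y'..<J} - {y}. \<Sum>l\<in>{..y} - {y'}. r k l)"
      using monotone_couplingsD(1)[OF r] y by (intro sum_nonneg) auto
    then show ?thesis
      using monotone_coupling_entry_excess[OF r y] monotone_couplingsD(1)[OF r, of y y'] y by simp
  qed
  have fin: "finite ?S" by simp
  have upper: "r y y' \<le> Min ?S" if r: "r \<in> ?C" for r
  proof -
    note nonneg = monotone_couplingsD(1)[OF r]
    have "r y y' \<le> (\<Sum>l<J. r y l)" using y nonneg by (intro member_le_sum) auto
    moreover have "r y y' \<le> (\<Sum>k<J. r k y')"
      using y nonneg by (intro member_le_sum[of y _ "\<lambda>k. r k y'"]) auto
    \<comment> \<open>The cell \<open>(y, y')\<close> lies in the block of rows from
      \<open>k\<close> on and columns below \<open>k\<close>.\<close>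
    moreover have "r y y' \<le> (\<Sum>j<k. p0 j - p1 j)" if k: "y' < k" "k \<le> y" for k
    proof -
      have "r y y' \<le> (\<Sum>l<k. r y l)" using k y nonneg by (intro member_le_sum) auto
      also have "\<dots> \<le> (\<Sum>j\<in>{k..<J}. \<Sum>l<k. r j l)"
        using k y nonneg
        by (intro member_le_sum[of y _ "\<lambda>j. \<Sum>l<k. r j l"]) (auto intro!: sum_nonneg)
      finally show ?thesis using monotone_coupling_delta[OF r] k y by simp
    qed
    ultimately show ?thesis
      using monotone_couplingsD(3,4)[OF r] y fin by (subst Min_ge_iff) auto
  qed
  obtain r where r: "r \<in> ?C"
    and "r y y' = 0 \<or> (\<forall>k\<in>{y'..<J} - {y}. \<forall>l\<in>{..y} - {y'}. r k l = 0)"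
    using monotone_coupling_entry_or_block_empty[OF q y] by blast
  \<comment> \<open>Both values are at most \<open>max 0 ?lo\<close>, which is itself a lower bound
    for the entry, so equality follows.\<close>
  then have "r y y' = 0 \<or> r y y' = ?lo"
    using monotone_coupling_entry_excess[OF r y] by auto
  with lower[OF r] have attain_lo: "\<exists>r\<in>?C. r y y' = max 0 ?lo"
    using r by (intro bexI[of _ r]) auto
  define t where "t = Min ?S"
  have t: "t \<le> x" if "x \<in> ?S" for x
    unfolding t_def using fin that by (rule Min_le)
  \<comment> \<open>The given coupling \<open>q\<close> has its entry between \<open>0\<close> and
    \<open>t\<close>.\<close>
  have "0 \<le> t" unfolding t_def using lower[OF q] upper[OF q] by linarith
  then have "\<exists>r\<in>?C. t \<le> r y y'"
    by (rule monotone_coupling_entry_ge_exists[OF q y]; intro t) auto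
  then have "\<exists>r\<in>?C. r y y' = Min ?S" using upper unfolding t_def by (meson order.antisym)
  with lower upper attain_lo show ?thesis by (auto simp: sharp_bounds_def)
qed

section \<open>From matrix entries to conditional probabilities\<close>

lemma sharp_bounds_divide:
  assumes "sharp_bounds C f lo hi" "0 < c"
  shows "sharp_bounds C (\<lambda>q. f q / c) (lo / c) (hi / c)"
  using assms by (auto simp: sharp_bounds_def divide_right_mono)

lemma sharp_bounds_complement:
  assumes "sharp_bounds C f lo hi" "\<And>q. q \<in> C \<Longrightarrow> g q = c - f q"
  shows "sharp_bounds C g (c - hi) (c - lo)"
  using assms by (auto simp: sharp_bounds_def)

theorem theorem3:
  fixes M :: "'a measure" and Z Y Y1 Y0 :: "'a \<Rightarrow> nat" and J y :: nat
  assumes "prob_space M"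
    and "J \<ge> 2"
    and "Z \<in> measurable M (count_space UNIV)"
    and "Y \<in> measurable M (count_space UNIV)"
    and "Y1 \<in> measurable M (count_space UNIV)"
    and "Y0 \<in> measurable M (count_space UNIV)"
    and "\<And>\<omega>. \<omega> \<in> space M \<Longrightarrow> Z \<omega> \<in> {0, 1}"
    and "\<And>\<omega>. \<omega> \<in> space M \<Longrightarrow> Y1 \<omega> \<in> {0..J - 1}"
    and "\<And>\<omega>. \<omega> \<in> space M \<Longrightarrow> Y0 \<omega> \<in> {0..J - 1}"
    and consistency1: "\<And>\<omega>. \<omega> \<in> space M \<Longrightarrow> Z \<omega> = 1 \<Longrightarrow> Y \<omega> = Y1 \<omega>"
    and consistency0: "\<And>\<omega>. \<omega> \<in> space M \<Longrightarrow> Z \<omega> = 0 \<Longrightarrow> Y \<omega> = Y0 \<omega>"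
    and monotonicity: "AE \<omega> in M. Y0 \<omega> \<le> Y1 \<omega>"
    and "y \<in> {0..J - 1}"
    and "\<P>(\<omega> in M. Z \<omega> = 1 \<and> Y \<omega> = y) > 0"
  shows
    "let p = treated_pr M Z Y;
         p1 = treated_pr M Z Y1;
         p0 = treated_pr M Z Y0;
         \<delta> = treated_delta M Z Y1 Y0;
         C = monotone_couplings J p1 p0;
         lo_ne = max 0 ((p y - p0 y) / p y);
         hi_ne = min 1 (\<delta> y / p y);
         lo = (\<lambda>y'. max 0 ((p y + (\<Sum>k<y'. p k) - (\<Sum>l\<le>y. p0 l) + p0 y') / p y));
         hi = (\<lambda>y'. Min ({1, p0 y' / p y} \<union> (\<lambda>k. \<delta> k / p y) ` {y'<..y}))
     in
       (lo_ne \<le> \<P>(\<omega> in M. Y0 \<omega> \<noteq> y \<bar> Z \<omega> = 1 \<and> Y \<omega> = y) \<and>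
        \<P>(\<omega> in M. Y0 \<omega> \<noteq> y \<bar> Z \<omega> = 1 \<and> Y \<omega> = y) \<le> hi_ne) \<and>
       sharp_bounds C (\<lambda>q. (\<Sum>l\<in>{..<J} - {y}. q y l) / p y) lo_ne hi_ne \<and>
       (\<forall>y'\<le>y.
         (lo y' \<le> \<P>(\<omega> in M. Y0 \<omega> = y' \<bar> Z \<omega> = 1 \<and> Y \<omega> = y) \<and>
          \<P>(\<omega> in M. Y0 \<omega> = y' \<bar> Z \<omega> = 1 \<and> Y \<omega> = y) \<le> hi y') \<and>
         sharp_bounds C (\<lambda>q. q y y' / p y) (lo y') (hi y'))"
proof -
  interpret prob_space M by fact
  define p p1 p0 where "p = treated_pr M Z Y" and "p1 = treated_pr M Z Y1"
    and "p0 = treated_pr M Z Y0"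
  define \<delta> C where "\<delta> = treated_delta M Z Y1 Y0" and "C = monotone_couplings J p1 p0"
  define lo where "lo y' = max 0 ((p y + (\<Sum>k<y'. p k) - (\<Sum>l\<le>y. p0 l) + p0 y') / p y)" for y'
  define hi where "hi y' = Min ({1, p0 y' / p y} \<union> (\<lambda>k. \<delta> k / p y) ` {y'<..y})" for y'
  define q where "q = treated_joint M Z Y1 Y0"
  have y: "y < J" using assms by auto
  have Y1: "Y1 \<omega> < J" and Y0: "Y0 \<omega> < J" if "\<omega> \<in> space M" for \<omega>
    using assms(2) assms(8,9)[OF that] by auto
  have "{\<omega> \<in> space M. Y \<omega> = k \<and> Z \<omega> = 1} = {\<omega> \<in> space M. Y1 \<omega> = k \<and> Z \<omega> = 1}" for k
    using consistency1 by auto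
  \<comment> \<open>Consistency makes the observed law among the treated the row marginal.\<close>
  then have p: "p = p1"
    by (auto simp: p_def p1_def treated_pr_def cond_prob_def)
  have \<delta>: "\<delta> k = (\<Sum>j<k. p0 j - p1 j)" for k
    by (simp add: \<delta>_def treated_delta_def p0_def p1_def)
  have py: "0 < p y"
  proof -
    have "prob {\<omega> \<in> space M. Z \<omega> = 1 \<and> Y \<omega> = y} \<le> prob {\<omega> \<in> space M. Z \<omega> = 1}"
      using assms(3,4) by (intro finite_measure_mono) (auto intro: measurable_sets)
    moreover have "{\<omega> \<in> space M. Y \<omega> = y \<and> Z \<omega> = 1} = {\<omega> \<in> space M. Z \<omega> = 1 \<and> Y \<omega> = y}"
      by auto
    ultimately show ?thesis
      using assms(14) by (simp add: p_def treated_pr_def cond_prob_def)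
  qed
  have q: "q \<in> C"
    unfolding q_def C_def p1_def p0_def
    by (rule treated_joint_in_monotone_couplings[OF assms(1,3,5,6) Y1 Y0 monotonicity])
  have cond: "\<P>(\<omega> in M. Y0 \<omega> \<in> A \<bar> Z \<omega> = 1 \<and> Y \<omega> = y) = (\<Sum>l\<in>{..<J} \<inter> A. q y l) / p y" for A
    unfolding q_def p_def
    by (rule cond_prob_Y0_eq_treated_joint[OF assms(1,3,5,6) Y0 consistency1 assms(14)])
  have sharp: "sharp_bounds C (\<lambda>q. q y y' / p y) (lo y') (hi y')" if "y' \<le> y" for y'
  proof -
    let ?S = "{p1 y, p0 y'} \<union> (\<lambda>k. \<Sum>j<k. p0 j - p1 j) ` {y'<..y}"
    \<comment> \<open>Division by \<open>p y > 0\<close> is monotone and commutes with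
      \<open>Min\<close>; the row constraint \<open>p1 y\<close> becomes \<open>1\<close>.\<close>
    have "Min ?S / p y = Min ((\<lambda>x. x / p y) ` ?S)"
      using py by (intro mono_Min_commute) (auto simp: mono_def divide_right_mono)
    also have "(\<lambda>x. x / p y) ` ?S = {1, p0 y' / p y} \<union> (\<lambda>k. \<delta> k / p y) ` {y'<..y}"
      using py by (simp add: image_Un image_image \<delta> p)
    finally have "Min ?S / p y = hi y'" by (simp add: hi_def)
    moreover have "max 0 (p1 y + (\<Sum>k<y'. p1 k) - (\<Sum>l\<le>y. p0 l) + p0 y') / p y = lo y'"
      using py by (simp add: lo_def p max_divide_distrib_right)
    ultimately show ?thesis
      using sharp_bounds_divide[OF sharp_bounds_monotone_coupling_entry[OF q[unfolded C_def] that y] py]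
      by (simp only: C_def)
  qed
  have sharp_ne: "sharp_bounds C (\<lambda>q. (\<Sum>l\<in>{..<J} - {y}. q y l) / p y)
      (max 0 ((p y - p0 y) / p y)) (min 1 (\<delta> y / p y))"
  proof -
    \<comment> \<open>Row \<open>y\<close> of every coupling sums to \<open>p y\<close>, so this is
      the complement of the diagonal entry and the two bounds swap.\<close>
    have "(\<Sum>l\<in>{..<J} - {y}. r y l) / p y = 1 - r y y / p y" if "r \<in> C" for r
      using monotone_couplingsD(3)[OF that[unfolded C_def] y] y py
      by (simp add: sum_diff1 p diff_divide_distrib)
    then have "sharp_bounds C (\<lambda>q. (\<Sum>l\<in>{..<J} - {y}. q y l) / p y) (1 - hi y) (1 - lo y)"
      by (rule sharp_bounds_complement[OF sharp[OF order.refl]])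
    \<comment> \<open>With \<open>y' = y\<close> the range \<open>{y<..y}\<close> is empty and
      \<open>hi y\<close> has no \<open>\<delta>\<close> term.\<close>
    moreover have "1 - hi y = max 0 ((p y - p0 y) / p y)"
      using py by (simp add: hi_def diff_divide_distrib min_def max_def)
    moreover have "1 - lo y = min 1 (\<delta> y / p y)"
    proof -
      \<comment> \<open>Adding \<open>p0 y\<close> cancels the last term of the sum up to
        \<open>y\<close>; the two remaining sums over indices below \<open>y\<close> differ by
        \<open>\<delta> y\<close>.\<close>
      have "(p y + (\<Sum>k<y. p k) - (\<Sum>l\<le>y. p0 l) + p0 y) / p y = 1 - \<delta> y / p y"
        using py by (simp add: \<delta> p sum_subtractf field_simps flip: lessThan_Suc_atMost)
      then show ?thesis by (auto simp: lo_def min_def max_def)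
    qed
    ultimately show ?thesis by simp
  qed
  have cond_ne: "\<P>(\<omega> in M. Y0 \<omega> \<noteq> y \<bar> Z \<omega> = 1 \<and> Y \<omega> = y) = (\<Sum>l\<in>{..<J} - {y}. q y l) / p y"
    using cond[of "- {y}"] by (simp add: Diff_eq)
  have cond_eq: "\<P>(\<omega> in M. Y0 \<omega> = y' \<bar> Z \<omega> = 1 \<and> Y \<omega> = y) = q y y' / p y" if "y' \<le> y" for y'
    using cond[of "{y'}"] that y by simp
  have "(max 0 ((p y - p0 y) / p y) \<le> \<P>(\<omega> in M. Y0 \<omega> \<noteq> y \<bar> Z \<omega> = 1 \<and> Y \<omega> = y) \<and>
      \<P>(\<omega> in M. Y0 \<omega> \<noteq> y \<bar> Z \<omega> = 1 \<and> Y \<omega> = y) \<le> min 1 (\<delta> y / p y)) \<and>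
    sharp_bounds C (\<lambda>q. (\<Sum>l\<in>{..<J} - {y}. q y l) / p y)
      (max 0 ((p y - p0 y) / p y)) (min 1 (\<delta> y / p y)) \<and>
    (\<forall>y'\<le>y. (lo y' \<le> \<P>(\<omega> in M. Y0 \<omega> = y' \<bar> Z \<omega> = 1 \<and> Y \<omega> = y) \<and>
      \<P>(\<omega> in M. Y0 \<omega> = y' \<bar> Z \<omega> = 1 \<and> Y \<omega> = y) \<le> hi y') \<and>
      sharp_bounds C (\<lambda>q. q y y' / p y) (lo y') (hi y'))"
  proof (intro conjI allI impI sharp_ne)
    fix y' assume y': "y' \<le> y"
    show "sharp_bounds C (\<lambda>q. q y y' / p y) (lo y') (hi y')" by (rule sharp[OF y'])
    then show "lo y' \<le> \<P>(\<omega> in M. Y0 \<omega> = y' \<bar> Z \<omega> = 1 \<and> Y \<omega> = y)"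
      and "\<P>(\<omega> in M. Y0 \<omega> = y' \<bar> Z \<omega> = 1 \<and> Y \<omega> = y) \<le> hi y'"
      unfolding cond_eq[OF y'] using q by (simp_all only: sharp_bounds_def)
  qed (use sharp_ne q in \<open>simp_all only: cond_ne sharp_bounds_def\<close>)
  then show ?thesis
    unfolding Let_def lo_def hi_def C_def \<delta>_def p_def p1_def p0_def .
qed

end
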